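(* Let $\Gamma$ be a set of formulas and let $\alpha,\beta,\gamma,t$ be formulas of the language $\mathbf L=\{\top,\sim,\wedge,\vee,\to\}$. In the logic $\mathcal{SN}$ (semi-intuitionistic logic with strong negation), with $\vdash$ denoting $\vdash_{\mathcal{SN}}$, the following properties hold: (a) $\Gamma\vdash({\sim}\alpha\wedge{\sim}\beta)\leftrightarrow_N{\sim}(\alpha\vee\beta)$. (b) $\Gamma\vdash(\alpha\wedge(\alpha\to_N\beta))\Rightarrow(\alpha\wedge({\sim}\alpha\vee\beta))$. (c) If $\Gamma\vdash\alpha\leftrightarrow_N\beta$ then $\Gamma\vdash\beta\leftrightarrow_N\alpha$. (d) $\Gamma\vdash\alpha\Rightarrow(\alpha\wedge(\alpha\vee\beta))$. (e) $\Gamma\vdash[\alpha\wedge[(\gamma\wedge\alpha)\vee(\beta\wedge\alpha)]]\Rightarrow[\alpha\wedge(\beta\vee\gamma)]$. (f) $\Gamma\vdash(\alpha\wedge(\beta\vee\gamma))\Rightarrow[\alpha\wedge((\gamma\wedge\alpha)\vee(\beta\wedge\alpha))]$. (g) $\Gamma\vdash({\sim}\beta\to_N{\sim}\alpha)\to_N(({\sim}\gamma\to_N{\sim}\alpha)\to_N({\sim}(\beta\wedge\gamma)\to_N{\sim}\alpha))$. (h) If $\Gamma\vdash\alpha\Rightarrow\beta$ and $\Gamma\vdash\alpha\Rightarrow\gamma$ then $\Gamma\vdash\alpha\Rightarrow(\beta\wedge\gamma)$ and $\Gamma\vdash\alpha\Rightarrow(\gamma\wedge\beta)$. (i) If $\Gamma\vdash\alpha\Rightarrow\beta$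 then $\Gamma\vdash\alpha\Rightarrow(\beta\vee\gamma)$ and $\Gamma\vdash\alpha\Rightarrow(\gamma\vee\beta)$. (j) If $\Gamma\vdash\alpha\Rightarrow\beta$ then $\Gamma\vdash(\alpha\wedge\gamma)\Rightarrow\beta$ and $\Gamma\vdash(\gamma\wedge\alpha)\Rightarrow\beta$. (k) $\Gamma,\ \alpha\Rightarrow\beta\ \vdash\ (\alpha\wedge\gamma)\Rightarrow(\beta\wedge\gamma)$. (l) $\Gamma,\ \alpha\Rightarrow\beta\ \vdash\ (\gamma\wedge\alpha)\Rightarrow(\gamma\wedge\beta)$. (m) $\Gamma,\ \alpha\Rightarrow\beta,\ \gamma\Rightarrow t\ \vdash\ (\alpha\wedge\gamma)\Rightarrow(\beta\wedge t)$. (n) $\Gamma\vdash[{\sim}(\alpha\to_N\beta)]\to_N(\alpha\wedge{\sim}\beta)$. (o) $\Gamma\vdash(\alpha\wedge{\sim}\alpha)\to_N\beta$. (p) $\Gamma\vdash(\alpha\wedge{\sim}\alpha)\Rightarrow(\beta\vee{\sim}\beta)$. (q) $\Gamma\vdash(\alpha\to_N\beta)\to_N[(\beta\to_N\alpha)\to_N[({\sim}(\beta\to\gamma))\to_N({\sim}(\alpha\to\gamma))]]$. (r) $\Gamma\vdash({\sim}\alpha\to_N{\sim}\beta)\to_N[({\sim}\beta\to_N{\sim}\alpha)\to_N[({\sim}(\gamma\to\alpha))\to_N({\sim}(\gamma\to\beta))]]$. (s) $\Gamma,\ \alpha\Rightarrow\beta,\ \beta\Rightarrow\alpha,\ \gamma\Rightarrow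 t,\ t\Rightarrow\gamma\ \vdash\ (\alpha\to\gamma)\Rightarrow(\beta\to t)$. (t) $\Gamma,\ \alpha\ \vdash\ \beta\Rightarrow\alpha$. (u) $\Gamma\vdash(\alpha\to\beta)\to_N(\alpha\to_N\beta)$.
   Context: Formulas are built inductively from a countably infinite set of propositional variables using the connectives of $\mathbf L=\{\top,\sim,\wedge,\vee,\to\}$, where $\top$ is a constant, $\sim$ is unary, and $\wedge,\vee,\to$ are binary. The following are abbreviations: $\alpha\to_N\beta:=\alpha\to(\alpha\wedge\beta)$; $\alpha\Rightarrow\beta:=(\alpha\to_N\beta)\wedge({\sim}\beta\to_N{\sim}\alpha)$; $\alpha\leftrightarrow_N\beta:=(\alpha\to_N\beta)\wedge(\beta\to_N\alpha)$. The logic $\mathcal{SN}$ (semi-intuitionistic logic with strong negation) is the Hilbert-style calculus with the following axiom schemata ($\alpha,\beta,\gamma$ arbitrary formulas): (A1) $(\alpha\to_N\beta)\to_N((\beta\to_N\gamma)\to_N(\alpha\to_N\gamma))$ (A2) $(\alpha\to_N\beta)\to_N((\alpha\to_N\gamma)\to_N(\alpha\to_N(\beta\wedge\gamma)))$ (A3) $(\alpha\wedge\beta)\to_N\alpha$ (A4) $(\alpha\wedge\beta)\to_N\beta$ (A5) $\alpha\to_N(\alpha\vee\beta)$ (A6) $\beta\to_N(\alpha\vee\beta)$ (A7) ${\sim}(\alpha\vee\beta)\to_N{\sim}\alpha$ (A8) ${\sim}(\alpha\vee\beta)\to_N{\sim}\beta$ (A9) $(\alpha\to_N\gamma)\to_N((\beta\to_N\gamma)\to_N((\alpha\vee\beta)\to_N\gamma))$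 (A10) $({\sim}\alpha\to_N{\sim}\beta)\to_N(({\sim}\alpha\to_N{\sim}\gamma)\to_N({\sim}\alpha\to_N{\sim}(\beta\vee\gamma)))$ (A11) $\alpha\Rightarrow({\sim}{\sim}\alpha)$ (A12) $({\sim}{\sim}\alpha)\Rightarrow\alpha$ (A13) $(\alpha\to_N\beta)\to_N[(\beta\to_N\alpha)\to_N[(\alpha\to\gamma)\to_N(\beta\to\gamma)]]$ (A14) $(\alpha\to_N\beta)\to_N[(\beta\to_N\alpha)\to_N[(\gamma\to\alpha)\to_N(\gamma\to\beta)]]$ (A15) $[(\alpha\wedge\beta)\to_N\gamma]\Rightarrow[\alpha\to_N(\beta\to_N\gamma)]$ (A16) $({\sim}(\alpha\wedge\beta))\Rightarrow({\sim}\alpha\vee{\sim}\beta)$ (A17) $({\sim}\alpha\vee{\sim}\beta)\Rightarrow({\sim}(\alpha\wedge\beta))$ (A18) $(\alpha\wedge({\sim}\alpha\vee\beta))\Rightarrow(\alpha\wedge(\alpha\to_N\beta))$ (A19) $(\alpha\to_N(\beta\to_N\gamma))\Rightarrow((\alpha\wedge\beta)\to_N\gamma)$ (A20) $({\sim}(\alpha\to\beta))\to_N(\alpha\wedge{\sim}\beta)$ (A21) $(\alpha\wedge{\sim}\beta)\to_N({\sim}(\alpha\to\beta))$ (A22) $[{\sim}(\alpha\wedge((\gamma\wedge\alpha)\vee(\beta\wedge\alpha)))]\to_N[{\sim}(\alpha\wedge(\beta\vee\gamma))]$ (A23) $\top$ The only inference rule is $\mathcal N$-Modus Ponens: from $\Gamma\vdash\phi$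 and $\Gamma\vdash\phi\to_N\gamma$ infer $\Gamma\vdash\gamma$. Thus $\Gamma\vdash\phi$ (short for $\Gamma\vdash_{\mathcal{SN}}\phi$) means that there is a finite derivation of $\phi$ from instances of the axioms and elements of $\Gamma$ using $\mathcal N$-Modus Ponens. The notation $\Gamma,\phi_1,\dots,\phi_n\vdash\psi$ means $\Gamma\cup\{\phi_1,\dots,\phi_n\}\vdash\psi$. *)

theory Defs
  imports Main
begin

text \<open>The connectives are written in bold to keep them apart from those of HOL.\<close>

datatype fm =
    Var nat
  | Truth           ("\<^bold>\<top>")
  | Neg fm          ("\<^bold>\<sim> _" [80] 80)
  | Conj fm fm      (infixr "\<^bold>\<and>" 70)
  | Disj fm fm      (infixr "\<^bold>\<or>" 65)
  | Imp fm fm       (infixr "\<^bold>\<rightarrow>" 60)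

abbreviation ImpN :: "fm \<Rightarrow> fm \<Rightarrow> fm"  (infixr "\<^bold>\<rightarrow>\<^sub>N" 60) where
  "\<alpha> \<^bold>\<rightarrow>\<^sub>N \<beta> \<equiv> \<alpha> \<^bold>\<rightarrow> (\<alpha> \<^bold>\<and> \<beta>)"

abbreviation StrongImp :: "fm \<Rightarrow> fm \<Rightarrow> fm"  (infixr "\<^bold>\<Rightarrow>" 60) where
  "\<alpha> \<^bold>\<Rightarrow> \<beta> \<equiv> (\<alpha> \<^bold>\<rightarrow>\<^sub>N \<beta>) \<^bold>\<and> (\<^bold>\<sim> \<beta> \<^bold>\<rightarrow>\<^sub>N \<^bold>\<sim> \<alpha>)"

abbreviation IffN :: "fm \<Rightarrow> fm \<Rightarrow> fm"  (infixr "\<^bold>\<leftrightarrow>\<^sub>N" 55) where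
  "\<alpha> \<^bold>\<leftrightarrow>\<^sub>N \<beta> \<equiv> (\<alpha> \<^bold>\<rightarrow>\<^sub>N \<beta>) \<^bold>\<and> (\<beta> \<^bold>\<rightarrow>\<^sub>N \<alpha>)"

inductive_set SN_axioms :: "fm set" where
  A1: "(\<alpha> \<^bold>\<rightarrow>\<^sub>N \<beta>) \<^bold>\<rightarrow>\<^sub>N ((\<beta> \<^bold>\<rightarrow>\<^sub>N \<gamma>) \<^bold>\<rightarrow>\<^sub>N (\<alpha> \<^bold>\<rightarrow>\<^sub>N \<gamma>)) \<in> SN_axioms"
| A2: "(\<alpha> \<^bold>\<rightarrow>\<^sub>N \<beta>) \<^bold>\<rightarrow>\<^sub>N ((\<alpha> \<^bold>\<rightarrow>\<^sub>N \<gamma>) \<^bold>\<rightarrow>\<^sub>N (\<alpha> \<^bold>\<rightarrow>\<^sub>N (\<beta> \<^bold>\<and> \<gamma>))) \<in> SN_axioms"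
| A3: "(\<alpha> \<^bold>\<and> \<beta>) \<^bold>\<rightarrow>\<^sub>N \<alpha> \<in> SN_axioms"
| A4: "(\<alpha> \<^bold>\<and> \<beta>) \<^bold>\<rightarrow>\<^sub>N \<beta> \<in> SN_axioms"
| A5: "\<alpha> \<^bold>\<rightarrow>\<^sub>N (\<alpha> \<^bold>\<or> \<beta>) \<in> SN_axioms"
| A6: "\<beta> \<^bold>\<rightarrow>\<^sub>N (\<alpha> \<^bold>\<or> \<beta>) \<in> SN_axioms"
| A7: "\<^bold>\<sim> (\<alpha> \<^bold>\<or> \<beta>) \<^bold>\<rightarrow>\<^sub>N \<^bold>\<sim> \<alpha> \<in> SN_axioms"
| A8: "\<^bold>\<sim> (\<alpha> \<^bold>\<or> \<beta>) \<^bold>\<rightarrow>\<^sub>N \<^bold>\<sim> \<beta> \<in> SN_axioms"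
| A9: "(\<alpha> \<^bold>\<rightarrow>\<^sub>N \<gamma>) \<^bold>\<rightarrow>\<^sub>N ((\<beta> \<^bold>\<rightarrow>\<^sub>N \<gamma>) \<^bold>\<rightarrow>\<^sub>N ((\<alpha> \<^bold>\<or> \<beta>) \<^bold>\<rightarrow>\<^sub>N \<gamma>)) \<in> SN_axioms"
| A10: "(\<^bold>\<sim> \<alpha> \<^bold>\<rightarrow>\<^sub>N \<^bold>\<sim> \<beta>) \<^bold>\<rightarrow>\<^sub>N ((\<^bold>\<sim> \<alpha> \<^bold>\<rightarrow>\<^sub>N \<^bold>\<sim> \<gamma>) \<^bold>\<rightarrow>\<^sub>N (\<^bold>\<sim> \<alpha> \<^bold>\<rightarrow>\<^sub>N \<^bold>\<sim> (\<beta> \<^bold>\<or> \<gamma>))) \<in> SN_axioms"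
| A11: "\<alpha> \<^bold>\<Rightarrow> (\<^bold>\<sim> (\<^bold>\<sim> \<alpha>)) \<in> SN_axioms"
| A12: "(\<^bold>\<sim> (\<^bold>\<sim> \<alpha>)) \<^bold>\<Rightarrow> \<alpha> \<in> SN_axioms"
| A13: "(\<alpha> \<^bold>\<rightarrow>\<^sub>N \<beta>) \<^bold>\<rightarrow>\<^sub>N ((\<beta> \<^bold>\<rightarrow>\<^sub>N \<alpha>) \<^bold>\<rightarrow>\<^sub>N ((\<alpha> \<^bold>\<rightarrow> \<gamma>) \<^bold>\<rightarrow>\<^sub>N (\<beta> \<^bold>\<rightarrow> \<gamma>))) \<in> SN_axioms"
| A14: "(\<alpha> \<^bold>\<rightarrow>\<^sub>N \<beta>) \<^bold>\<rightarrow>\<^sub>N ((\<beta> \<^bold>\<rightarrow>\<^sub>N \<alpha>) \<^bold>\<rightarrow>\<^sub>N ((\<gamma> \<^bold>\<rightarrow> \<alpha>) \<^bold>\<rightarrow>\<^sub>N (\<gamma> \<^bold>\<rightarrow> \<beta>))) \<in> SN_axioms"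
| A15: "((\<alpha> \<^bold>\<and> \<beta>) \<^bold>\<rightarrow>\<^sub>N \<gamma>) \<^bold>\<Rightarrow> (\<alpha> \<^bold>\<rightarrow>\<^sub>N (\<beta> \<^bold>\<rightarrow>\<^sub>N \<gamma>)) \<in> SN_axioms"
| A16: "(\<^bold>\<sim> (\<alpha> \<^bold>\<and> \<beta>)) \<^bold>\<Rightarrow> (\<^bold>\<sim> \<alpha> \<^bold>\<or> \<^bold>\<sim> \<beta>) \<in> SN_axioms"
| A17: "(\<^bold>\<sim> \<alpha> \<^bold>\<or> \<^bold>\<sim> \<beta>) \<^bold>\<Rightarrow> (\<^bold>\<sim> (\<alpha> \<^bold>\<and> \<beta>)) \<in> SN_axioms"
| A18: "(\<alpha> \<^bold>\<and> (\<^bold>\<sim> \<alpha> \<^bold>\<or> \<beta>)) \<^bold>\<Rightarrow> (\<alpha> \<^bold>\<and> (\<alpha> \<^bold>\<rightarrow>\<^sub>N \<beta>)) \<in> SN_axioms"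
| A19: "(\<alpha> \<^bold>\<rightarrow>\<^sub>N (\<beta> \<^bold>\<rightarrow>\<^sub>N \<gamma>)) \<^bold>\<Rightarrow> ((\<alpha> \<^bold>\<and> \<beta>) \<^bold>\<rightarrow>\<^sub>N \<gamma>) \<in> SN_axioms"
| A20: "(\<^bold>\<sim> (\<alpha> \<^bold>\<rightarrow> \<beta>)) \<^bold>\<rightarrow>\<^sub>N (\<alpha> \<^bold>\<and> \<^bold>\<sim> \<beta>) \<in> SN_axioms"
| A21: "(\<alpha> \<^bold>\<and> \<^bold>\<sim> \<beta>) \<^bold>\<rightarrow>\<^sub>N (\<^bold>\<sim> (\<alpha> \<^bold>\<rightarrow> \<beta>)) \<in> SN_axioms"
| A22: "(\<^bold>\<sim> (\<alpha> \<^bold>\<and> ((\<gamma> \<^bold>\<and> \<alpha>) \<^bold>\<or> (\<beta> \<^bold>\<and> \<alpha>)))) \<^bold>\<rightarrow>\<^sub>N (\<^bold>\<sim> (\<alpha> \<^bold>\<and> (\<beta> \<^bold>\<or> \<gamma>))) \<in> SN_axioms"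
| A23: "\<^bold>\<top> \<in> SN_axioms"

inductive SN_derives :: "fm set \<Rightarrow> fm \<Rightarrow> bool"  (infix "\<turnstile>" 50) for \<Gamma> :: "fm set" where
  ax: "\<phi> \<in> SN_axioms \<Longrightarrow> \<Gamma> \<turnstile> \<phi>"
| hyp: "\<phi> \<in> \<Gamma> \<Longrightarrow> \<Gamma> \<turnstile> \<phi>"
| N_MP: "\<Gamma> \<turnstile> \<phi> \<Longrightarrow> \<Gamma> \<turnstile> \<phi> \<^bold>\<rightarrow>\<^sub>N \<gamma> \<Longrightarrow> \<Gamma> \<turnstile> \<gamma>"

end

theory Submission
  imports Defs
begin

text \<open>
  The weak implication \<open>\<^bold>\<rightarrow>\<^sub>N\<close> satisfies the deduction theorem (\<open>deduction\<close>): (A15) is currying, which yields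
  \<open>\<alpha> \<^bold>\<rightarrow>\<^sub>N (\<beta> \<^bold>\<rightarrow>\<^sub>N \<alpha>)\<close> from (A3), and (A19) is uncurrying, which together with (A1) and (A2)
  yields closure under modus ponens below a hypothesis. Hence \<open>\<^bold>\<and>\<close>, \<open>\<^bold>\<or>\<close>, \<open>\<^bold>\<rightarrow>\<^sub>N\<close> obey positive
  intuitionistic logic.

  The axioms on \<open>\<^bold>\<sim>\<close> say that a negated compound formula is equivalent to a combination of
  its components and their negations, as in Nelson's constructive logic:
  \<open>\<^bold>\<sim> (\<alpha> \<^bold>\<or> \<beta>)\<close> to \<open>\<^bold>\<sim> \<alpha> \<^bold>\<and> \<^bold>\<sim> \<beta>\<close>, \<open>\<^bold>\<sim> (\<alpha> \<^bold>\<and> \<beta>)\<close> to \<open>\<^bold>\<sim> \<alpha> \<^bold>\<or> \<^bold>\<sim> \<beta>\<close>,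
  \<open>\<^bold>\<sim> (\<alpha> \<^bold>\<rightarrow> \<beta>)\<close> to \<open>\<alpha> \<^bold>\<and> \<^bold>\<sim> \<beta>\<close> and \<open>\<^bold>\<sim> \<^bold>\<sim> \<alpha>\<close> to \<open>\<alpha>\<close>. Each equivalence gives a right rule and a
  left rule (\<open>right_rules\<close>, \<open>left_rules\<close>). Read as rewrite rules they take goals and antecedents
  apart, as invertible rules of a sequent calculus do, until a goal is among its hypotheses or is
  a disjunction of which one side is.
  This settles most of the claims. A strong implication \<open>\<alpha> \<^bold>\<Rightarrow> \<beta>\<close> is a pair of weak ones, and
  the two are proved separately.

  Two points need an extra idea. A contradiction proves everything (\<open>ex_falso\<close>) because
  (A18) turns \<open>\<^bold>\<sim> \<alpha> \<^bold>\<or> \<beta>\<close>, in the presence of \<open>\<alpha>\<close>, into \<open>\<alpha> \<^bold>\<rightarrow>\<^sub>N \<beta>\<close>. And \<open>\<alpha> \<^bold>\<rightarrow> \<beta>\<close> implies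
  \<open>\<alpha> \<^bold>\<rightarrow>\<^sub>N \<beta>\<close> (\<open>imp_impN\<close>) because under the hypothesis \<open>\<alpha>\<close> the formulas \<open>\<beta>\<close> and \<open>\<alpha> \<^bold>\<and> \<beta>\<close> are equivalent,
  so that (A14) allows replacing one by the other to the right of \<open>\<^bold>\<rightarrow>\<close>.
\<close>

section \<open>The deduction theorem\<close>

lemma derives_mono: "\<Gamma> \<turnstile> \<phi> \<Longrightarrow> \<Gamma> \<subseteq> \<Delta> \<Longrightarrow> \<Delta> \<turnstile> \<phi>"
  by (induction rule: SN_derives.induct) (auto intro: SN_derives.intros)

lemma conjunct1: "\<Gamma> \<turnstile> \<alpha> \<^bold>\<and> \<beta> \<Longrightarrow> \<Gamma> \<turnstile> \<alpha>"
  by (rule N_MP, assumption, rule ax, rule A3)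

lemma conjunct2: "\<Gamma> \<turnstile> \<alpha> \<^bold>\<and> \<beta> \<Longrightarrow> \<Gamma> \<turnstile> \<beta>"
  by (rule N_MP, assumption, rule ax, rule A4)

lemma impN_trans: "\<Gamma> \<turnstile> \<alpha> \<^bold>\<rightarrow>\<^sub>N \<beta> \<Longrightarrow> \<Gamma> \<turnstile> \<beta> \<^bold>\<rightarrow>\<^sub>N \<gamma> \<Longrightarrow> \<Gamma> \<turnstile> \<alpha> \<^bold>\<rightarrow>\<^sub>N \<gamma>"
  by (rule N_MP, assumption, rule N_MP, assumption, rule ax, rule A1)

lemma impN_refl: "\<Gamma> \<turnstile> \<alpha> \<^bold>\<rightarrow>\<^sub>N \<alpha>"
  by (rule impN_trans[OF conjunct1[OF ax[OF A11]] conjunct1[OF ax[OF A12]]])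

lemma impN_conj: "\<Gamma> \<turnstile> \<alpha> \<^bold>\<rightarrow>\<^sub>N \<beta> \<Longrightarrow> \<Gamma> \<turnstile> \<alpha> \<^bold>\<rightarrow>\<^sub>N \<gamma> \<Longrightarrow> \<Gamma> \<turnstile> \<alpha> \<^bold>\<rightarrow>\<^sub>N (\<beta> \<^bold>\<and> \<gamma>)"
  by (rule N_MP, assumption, rule N_MP, assumption, rule ax, rule A2)

lemma conj_impN_iff: "\<Gamma> \<turnstile> (\<alpha> \<^bold>\<and> \<beta>) \<^bold>\<rightarrow>\<^sub>N \<gamma> \<longleftrightarrow> \<Gamma> \<turnstile> \<alpha> \<^bold>\<rightarrow>\<^sub>N (\<beta> \<^bold>\<rightarrow>\<^sub>N \<gamma>)"
  using N_MP[OF _ conjunct1[OF ax[OF A15]]] N_MP[OF _ conjunct1[OF ax[OF A19]]] by blast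

lemma impN_const: "\<Gamma> \<turnstile> \<beta> \<Longrightarrow> \<Gamma> \<turnstile> \<alpha> \<^bold>\<rightarrow>\<^sub>N \<beta>"
  using N_MP[OF _ iffD1[OF conj_impN_iff ax[OF A3]]] .

text \<open>
  The step for modus ponens contracts \<open>\<alpha>\<close>: uncurrying gives \<open>(\<alpha> \<^bold>\<and> \<phi>) \<^bold>\<rightarrow>\<^sub>N \<gamma>\<close>, and the
  antecedent \<open>\<alpha> \<^bold>\<and> \<phi>\<close> follows from \<open>\<alpha>\<close> alone.
\<close>
lemma deduction: "insert \<alpha> \<Gamma> \<turnstile> \<phi> \<Longrightarrow> \<Gamma> \<turnstile> \<alpha> \<^bold>\<rightarrow>\<^sub>N \<phi>"
proof (induction rule: SN_derives.induct)
  case (ax \<phi>)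
  then show ?case by (rule impN_const[OF SN_derives.ax])
next
  case (hyp \<phi>)
  then show ?case by (auto intro: impN_refl impN_const SN_derives.hyp)
next
  case (N_MP \<phi> \<gamma>)
  have "\<Gamma> \<turnstile> (\<alpha> \<^bold>\<and> \<phi>) \<^bold>\<rightarrow>\<^sub>N \<gamma>"
    using N_MP.IH(2) by (simp add: conj_impN_iff)
  with impN_conj[OF impN_refl N_MP.IH(1)] show ?case by (rule impN_trans)
qed

lemma N_MP_hyp: "\<alpha> \<^bold>\<rightarrow>\<^sub>N \<beta> \<in> \<Gamma> \<Longrightarrow> \<Gamma> \<turnstile> \<alpha> \<Longrightarrow> \<Gamma> \<turnstile> \<beta>"
  by (blast intro: N_MP hyp)

section \<open>Right and left rules for the connectives\<close>

lemma conj_iff: "\<Gamma> \<turnstile> \<alpha> \<^bold>\<and> \<beta> \<longleftrightarrow> \<Gamma> \<turnstile> \<alpha> \<and> \<Gamma> \<turnstile> \<beta>"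
  using conjunct1 conjunct2 N_MP[OF ax[OF A23] impN_conj[OF impN_const impN_const]] by blast

lemma disjI1: "\<Gamma> \<turnstile> \<alpha> \<Longrightarrow> \<Gamma> \<turnstile> \<alpha> \<^bold>\<or> \<beta>"
  by (rule N_MP, assumption, rule ax, rule A5)

lemma disjI2: "\<Gamma> \<turnstile> \<beta> \<Longrightarrow> \<Gamma> \<turnstile> \<alpha> \<^bold>\<or> \<beta>"
  by (rule N_MP, assumption, rule ax, rule A6)

lemma disj_impN_iff: "\<Gamma> \<turnstile> (\<alpha> \<^bold>\<or> \<beta>) \<^bold>\<rightarrow>\<^sub>N \<gamma> \<longleftrightarrow> \<Gamma> \<turnstile> \<alpha> \<^bold>\<rightarrow>\<^sub>N \<gamma> \<and> \<Gamma> \<turnstile> \<beta> \<^bold>\<rightarrow>\<^sub>N \<gamma>"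
  using impN_trans[OF ax[OF A5]] impN_trans[OF ax[OF A6]]
    N_MP[OF _ N_MP[OF _ ax[OF A9]]] by blast

text \<open>The next two lemmas turn an equivalence into a right rule and a left rule.\<close>

lemma iffN_derives_cong: "\<Gamma> \<turnstile> \<alpha> \<^bold>\<leftrightarrow>\<^sub>N \<beta> \<Longrightarrow> \<Gamma> \<turnstile> \<alpha> \<longleftrightarrow> \<Gamma> \<turnstile> \<beta>"
  unfolding conj_iff using N_MP by blast

lemma iffN_impN_cong: "\<Gamma> \<turnstile> \<alpha> \<^bold>\<leftrightarrow>\<^sub>N \<beta> \<Longrightarrow> \<Gamma> \<turnstile> \<alpha> \<^bold>\<rightarrow>\<^sub>N \<gamma> \<longleftrightarrow> \<Gamma> \<turnstile> \<beta> \<^bold>\<rightarrow>\<^sub>N \<gamma>"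
  unfolding conj_iff using impN_trans by blast

lemma neg_neg_iffN: "\<Gamma> \<turnstile> \<^bold>\<sim> \<^bold>\<sim> \<alpha> \<^bold>\<leftrightarrow>\<^sub>N \<alpha>"
  using ax[OF A11, of \<Gamma> \<alpha>] ax[OF A12, of \<Gamma> \<alpha>] by (simp add: conj_iff)

lemma neg_conj_iffN: "\<Gamma> \<turnstile> \<^bold>\<sim> (\<alpha> \<^bold>\<and> \<beta>) \<^bold>\<leftrightarrow>\<^sub>N (\<^bold>\<sim> \<alpha> \<^bold>\<or> \<^bold>\<sim> \<beta>)"
  using ax[OF A16, of \<Gamma> \<alpha> \<beta>] ax[OF A17, of \<Gamma> \<alpha> \<beta>] by (simp add: conj_iff)

lemma neg_imp_iffN: "\<Gamma> \<turnstile> \<^bold>\<sim> (\<alpha> \<^bold>\<rightarrow> \<beta>) \<^bold>\<leftrightarrow>\<^sub>N (\<alpha> \<^bold>\<and> \<^bold>\<sim> \<beta>)"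
  using ax[OF A20, of \<Gamma> \<alpha> \<beta>] ax[OF A21, of \<Gamma> \<alpha> \<beta>] by (simp add: conj_iff)

text \<open>
  (A10) introduces \<open>\<^bold>\<sim> (\<alpha> \<^bold>\<or> \<beta>)\<close> only below a negated antecedent. The antecedent
  \<open>\<^bold>\<sim> \<alpha> \<^bold>\<and> \<^bold>\<sim> \<beta>\<close> takes that form once it is doubly negated.
\<close>
lemma neg_disj_iffN: "\<Gamma> \<turnstile> \<^bold>\<sim> (\<alpha> \<^bold>\<or> \<beta>) \<^bold>\<leftrightarrow>\<^sub>N (\<^bold>\<sim> \<alpha> \<^bold>\<and> \<^bold>\<sim> \<beta>)"
proof -
  let ?\<delta> = "\<^bold>\<sim> \<alpha> \<^bold>\<and> \<^bold>\<sim> \<beta>"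
  have "\<Gamma> \<turnstile> \<^bold>\<sim> \<^bold>\<sim> ?\<delta> \<^bold>\<rightarrow>\<^sub>N \<^bold>\<sim> \<alpha>" "\<Gamma> \<turnstile> \<^bold>\<sim> \<^bold>\<sim> ?\<delta> \<^bold>\<rightarrow>\<^sub>N \<^bold>\<sim> \<beta>"
    unfolding iffN_impN_cong[OF neg_neg_iffN] by (rule ax[OF A3], rule ax[OF A4])
  then have "\<Gamma> \<turnstile> \<^bold>\<sim> \<^bold>\<sim> ?\<delta> \<^bold>\<rightarrow>\<^sub>N \<^bold>\<sim> (\<alpha> \<^bold>\<or> \<beta>)"
    by (rule N_MP[OF _ N_MP[OF _ ax[OF A10]], rotated])
  then have "\<Gamma> \<turnstile> ?\<delta> \<^bold>\<rightarrow>\<^sub>N \<^bold>\<sim> (\<alpha> \<^bold>\<or> \<beta>)"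
    unfolding iffN_impN_cong[OF neg_neg_iffN] .
  moreover have "\<Gamma> \<turnstile> \<^bold>\<sim> (\<alpha> \<^bold>\<or> \<beta>) \<^bold>\<rightarrow>\<^sub>N ?\<delta>"
    by (rule impN_conj[OF ax[OF A7] ax[OF A8]])
  ultimately show ?thesis by (simp add: conj_iff)
qed

lemmas right_rules = conj_iff
  neg_neg_iffN[THEN iffN_derives_cong] neg_conj_iffN[THEN iffN_derives_cong]
  neg_disj_iffN[THEN iffN_derives_cong] neg_imp_iffN[THEN iffN_derives_cong]

lemmas left_rules = conj_impN_iff disj_impN_iff
  neg_neg_iffN[THEN iffN_impN_cong] neg_conj_iffN[THEN iffN_impN_cong]
  neg_disj_iffN[THEN iffN_impN_cong] neg_imp_iffN[THEN iffN_impN_cong]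

lemmas decompose = right_rules left_rules hyp

section \<open>Consequences for weak implication\<close>

lemma ex_falso: "\<Gamma> \<turnstile> \<alpha> \<Longrightarrow> \<Gamma> \<turnstile> \<^bold>\<sim> \<alpha> \<Longrightarrow> \<Gamma> \<turnstile> \<beta>"
proof -
  assume \<alpha>: "\<Gamma> \<turnstile> \<alpha>" and "\<Gamma> \<turnstile> \<^bold>\<sim> \<alpha>"
  then have "\<Gamma> \<turnstile> \<alpha> \<^bold>\<and> (\<^bold>\<sim> \<alpha> \<^bold>\<or> \<beta>)" by (simp add: conj_iff disjI1)
  then have "\<Gamma> \<turnstile> \<alpha> \<^bold>\<and> (\<alpha> \<^bold>\<rightarrow>\<^sub>N \<beta>)" by (rule N_MP[OF _ conjunct1[OF ax[OF A18]]])
  then show ?thesis using N_MP[OF \<alpha>] by (simp add: conj_iff)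
qed

lemma ex_falso_hyp: "\<alpha> \<in> \<Gamma> \<Longrightarrow> \<^bold>\<sim> \<alpha> \<in> \<Gamma> \<Longrightarrow> \<Gamma> \<turnstile> \<beta>"
  by (blast intro: ex_falso hyp)

text \<open>
  Since \<open>\<alpha> \<^bold>\<rightarrow>\<^sub>N \<beta>\<close> is \<open>\<alpha> \<^bold>\<rightarrow> (\<alpha> \<^bold>\<and> \<beta>)\<close>, its negation yields \<open>\<alpha>\<close> and either \<open>\<^bold>\<sim> \<alpha>\<close>, which is
  contradictory, or \<open>\<^bold>\<sim> \<beta>\<close>.
\<close>
lemma neg_impN: "\<Gamma> \<turnstile> (\<^bold>\<sim> (\<alpha> \<^bold>\<rightarrow>\<^sub>N \<beta>)) \<^bold>\<rightarrow>\<^sub>N (\<alpha> \<^bold>\<and> \<^bold>\<sim> \<beta>)"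
proof -
  have "insert \<alpha> \<Gamma> \<turnstile> \<^bold>\<sim> \<alpha> \<^bold>\<rightarrow>\<^sub>N (\<alpha> \<^bold>\<and> \<^bold>\<sim> \<beta>)"
    by (intro deduction ex_falso_hyp[of \<alpha>]) simp_all
  moreover have "insert \<alpha> \<Gamma> \<turnstile> \<^bold>\<sim> \<beta> \<^bold>\<rightarrow>\<^sub>N (\<alpha> \<^bold>\<and> \<^bold>\<sim> \<beta>)"
    by (rule deduction) (simp add: decompose)
  ultimately have "\<Gamma> \<turnstile> \<alpha> \<^bold>\<rightarrow>\<^sub>N (\<^bold>\<sim> (\<alpha> \<^bold>\<and> \<beta>) \<^bold>\<rightarrow>\<^sub>N (\<alpha> \<^bold>\<and> \<^bold>\<sim> \<beta>))"
    by (intro deduction[of \<alpha>]) (simp add: left_rules)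
  then show ?thesis by (simp add: left_rules)
qed

lemma imp_impN: "\<Gamma> \<turnstile> (\<alpha> \<^bold>\<rightarrow> \<beta>) \<^bold>\<rightarrow>\<^sub>N (\<alpha> \<^bold>\<rightarrow>\<^sub>N \<beta>)"
proof (intro deduction)
  let ?\<Delta> = "insert \<alpha> (insert (\<alpha> \<^bold>\<rightarrow> \<beta>) \<Gamma>)"
  have "?\<Delta> \<turnstile> \<beta> \<^bold>\<rightarrow>\<^sub>N (\<alpha> \<^bold>\<and> \<beta>)" "?\<Delta> \<turnstile> (\<alpha> \<^bold>\<and> \<beta>) \<^bold>\<rightarrow>\<^sub>N \<beta>"
    by (rule deduction, simp add: decompose) (rule ax[OF A4])
  then have "?\<Delta> \<turnstile> (\<alpha> \<^bold>\<rightarrow> \<beta>) \<^bold>\<rightarrow>\<^sub>N (\<alpha> \<^bold>\<rightarrow>\<^sub>N \<beta>)"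
    using ax[OF A14, of ?\<Delta> \<beta> "\<alpha> \<^bold>\<and> \<beta>" \<alpha>] N_MP by blast
  then have "?\<Delta> \<turnstile> \<alpha> \<^bold>\<rightarrow>\<^sub>N \<beta>"
    by (rule N_MP[rotated]) (simp add: hyp)
  then show "?\<Delta> \<turnstile> \<beta>"
    by (rule N_MP[rotated]) (simp add: hyp)
qed

text \<open>
  In the next three proofs the deduction theorem is first applied only to antecedents that are
  implications, so that the negated antecedent stays in place for the left rules.
\<close>
lemma neg_conj_impN:
  "\<Gamma> \<turnstile> (\<^bold>\<sim> \<beta> \<^bold>\<rightarrow>\<^sub>N \<^bold>\<sim> \<alpha>) \<^bold>\<rightarrow>\<^sub>N ((\<^bold>\<sim> \<gamma> \<^bold>\<rightarrow>\<^sub>N \<^bold>\<sim> \<alpha>) \<^bold>\<rightarrow>\<^sub>N (\<^bold>\<sim> (\<beta> \<^bold>\<and> \<gamma>) \<^bold>\<rightarrow>\<^sub>N \<^bold>\<sim> \<alpha>))"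
  by (intro deduction[of "_ \<^bold>\<rightarrow> (_ \<^bold>\<and> _)"]) (simp add: left_rules hyp)

lemma neg_imp_antecedent:
  "\<Gamma> \<turnstile> (\<alpha> \<^bold>\<rightarrow>\<^sub>N \<beta>) \<^bold>\<rightarrow>\<^sub>N ((\<beta> \<^bold>\<rightarrow>\<^sub>N \<alpha>) \<^bold>\<rightarrow>\<^sub>N ((\<^bold>\<sim> (\<beta> \<^bold>\<rightarrow> \<gamma>)) \<^bold>\<rightarrow>\<^sub>N (\<^bold>\<sim> (\<alpha> \<^bold>\<rightarrow> \<gamma>))))"
  by (intro deduction[of "_ \<^bold>\<rightarrow> (_ \<^bold>\<and> _)"], simp add: left_rules, intro deduction)
    (auto simp: decompose intro: N_MP_hyp[of \<beta> \<alpha>])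

lemma neg_imp_consequent:
  "\<Gamma> \<turnstile> (\<^bold>\<sim> \<alpha> \<^bold>\<rightarrow>\<^sub>N \<^bold>\<sim> \<beta>) \<^bold>\<rightarrow>\<^sub>N ((\<^bold>\<sim> \<beta> \<^bold>\<rightarrow>\<^sub>N \<^bold>\<sim> \<alpha>) \<^bold>\<rightarrow>\<^sub>N ((\<^bold>\<sim> (\<gamma> \<^bold>\<rightarrow> \<alpha>)) \<^bold>\<rightarrow>\<^sub>N (\<^bold>\<sim> (\<gamma> \<^bold>\<rightarrow> \<beta>))))"
  by (intro deduction[of "_ \<^bold>\<rightarrow> (_ \<^bold>\<and> _)"], simp add: left_rules, intro deduction)
    (auto simp: decompose intro: N_MP_hyp[of "\<^bold>\<sim> \<alpha>" "\<^bold>\<sim> \<beta>"])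

section \<open>Consequences for strong implication\<close>

lemma strong_refl: "\<Gamma> \<turnstile> \<alpha> \<^bold>\<Rightarrow> \<alpha>"
  by (simp add: conj_iff impN_refl)

lemma strong_trans: "\<Gamma> \<turnstile> \<alpha> \<^bold>\<Rightarrow> \<beta> \<Longrightarrow> \<Gamma> \<turnstile> \<beta> \<^bold>\<Rightarrow> \<gamma> \<Longrightarrow> \<Gamma> \<turnstile> \<alpha> \<^bold>\<Rightarrow> \<gamma>"
  unfolding conj_iff using impN_trans by blast

lemma strong_conj_elim1: "\<Gamma> \<turnstile> (\<alpha> \<^bold>\<and> \<beta>) \<^bold>\<Rightarrow> \<alpha>"
  unfolding conj_iff
  by (intro conjI ax[OF A3] deduction) (simp add: decompose disjI1)

lemma strong_conj_elim2: "\<Gamma> \<turnstile> (\<alpha> \<^bold>\<and> \<beta>) \<^bold>\<Rightarrow> \<beta>"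
  unfolding conj_iff
  by (intro conjI ax[OF A4] deduction) (simp add: decompose disjI2)

lemma strong_conj_intro: "\<Gamma> \<turnstile> \<alpha> \<^bold>\<Rightarrow> \<beta> \<Longrightarrow> \<Gamma> \<turnstile> \<alpha> \<^bold>\<Rightarrow> \<gamma> \<Longrightarrow> \<Gamma> \<turnstile> \<alpha> \<^bold>\<Rightarrow> (\<beta> \<^bold>\<and> \<gamma>)"
  by (simp add: right_rules left_rules impN_conj)

lemma strong_disj_intro1: "\<Gamma> \<turnstile> \<alpha> \<^bold>\<Rightarrow> (\<alpha> \<^bold>\<or> \<beta>)"
  unfolding conj_iff by (intro conjI ax[OF A5] ax[OF A7])

lemma strong_disj_intro2: "\<Gamma> \<turnstile> \<beta> \<^bold>\<Rightarrow> (\<alpha> \<^bold>\<or> \<beta>)"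
  unfolding conj_iff by (intro conjI ax[OF A6] ax[OF A8])

lemma strong_conj_mono:
  "\<Gamma> \<turnstile> \<alpha> \<^bold>\<Rightarrow> \<beta> \<Longrightarrow> \<Gamma> \<turnstile> \<gamma> \<^bold>\<Rightarrow> \<delta> \<Longrightarrow> \<Gamma> \<turnstile> (\<alpha> \<^bold>\<and> \<gamma>) \<^bold>\<Rightarrow> (\<beta> \<^bold>\<and> \<delta>)"
  by (blast intro: strong_conj_intro strong_trans strong_conj_elim1 strong_conj_elim2)

lemma strong_absorption: "\<Gamma> \<turnstile> \<alpha> \<^bold>\<Rightarrow> (\<alpha> \<^bold>\<and> (\<alpha> \<^bold>\<or> \<beta>))"
  by (rule strong_conj_intro[OF strong_refl strong_disj_intro1])

text \<open>
  In the negated half, \<open>\<^bold>\<sim> (\<alpha> \<^bold>\<and> (\<^bold>\<sim> \<alpha> \<^bold>\<or> \<beta>))\<close> splits into the cases \<open>\<^bold>\<sim> \<alpha>\<close> and \<open>\<alpha>, \<^bold>\<sim> \<beta>\<close>. In the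
  second one, \<open>\<alpha>\<close> and \<open>\<^bold>\<sim> (\<alpha> \<^bold>\<and> \<beta>)\<close> refute \<open>\<alpha> \<^bold>\<rightarrow>\<^sub>N \<beta>\<close>, which is \<open>\<alpha> \<^bold>\<rightarrow> (\<alpha> \<^bold>\<and> \<beta>)\<close>.
\<close>
lemma strong_detachment: "\<Gamma> \<turnstile> (\<alpha> \<^bold>\<and> (\<alpha> \<^bold>\<rightarrow>\<^sub>N \<beta>)) \<^bold>\<Rightarrow> (\<alpha> \<^bold>\<and> (\<^bold>\<sim> \<alpha> \<^bold>\<or> \<beta>))"
proof -
  have "insert (\<alpha> \<^bold>\<rightarrow>\<^sub>N \<beta>) (insert \<alpha> \<Gamma>) \<turnstile> \<alpha> \<^bold>\<and> (\<^bold>\<sim> \<alpha> \<^bold>\<or> \<beta>)"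
    using N_MP_hyp[of \<alpha> \<beta>] by (simp add: decompose disjI2)
  then have "\<Gamma> \<turnstile> (\<alpha> \<^bold>\<and> (\<alpha> \<^bold>\<rightarrow>\<^sub>N \<beta>)) \<^bold>\<rightarrow>\<^sub>N (\<alpha> \<^bold>\<and> (\<^bold>\<sim> \<alpha> \<^bold>\<or> \<beta>))"
    by (simp add: left_rules deduction)
  moreover have "\<Gamma> \<turnstile> \<^bold>\<sim> (\<alpha> \<^bold>\<and> (\<^bold>\<sim> \<alpha> \<^bold>\<or> \<beta>)) \<^bold>\<rightarrow>\<^sub>N \<^bold>\<sim> (\<alpha> \<^bold>\<and> (\<alpha> \<^bold>\<rightarrow>\<^sub>N \<beta>))"
    by (simp add: left_rules, intro conjI deduction)
      (simp_all add: decompose disjI1 disjI2)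
  ultimately show ?thesis by (simp add: conj_iff)
qed

lemma strong_distrib_collect: "\<Gamma> \<turnstile> (\<alpha> \<^bold>\<and> ((\<gamma> \<^bold>\<and> \<alpha>) \<^bold>\<or> (\<beta> \<^bold>\<and> \<alpha>))) \<^bold>\<Rightarrow> (\<alpha> \<^bold>\<and> (\<beta> \<^bold>\<or> \<gamma>))"
proof -
  have "\<Gamma> \<turnstile> (\<gamma> \<^bold>\<and> \<alpha>) \<^bold>\<or> (\<beta> \<^bold>\<and> \<alpha>) \<^bold>\<Rightarrow> (\<beta> \<^bold>\<or> \<gamma>)"
    unfolding conj_iff
    by (simp add: left_rules, intro conjI deduction)
      (simp_all add: decompose disjI1 disjI2)
  then show ?thesis by (rule strong_conj_mono[OF strong_refl])
qed

lemma strong_distrib: "\<Gamma> \<turnstile> (\<alpha> \<^bold>\<and> (\<beta> \<^bold>\<or> \<gamma>)) \<^bold>\<Rightarrow> (\<alpha> \<^bold>\<and> ((\<gamma> \<^bold>\<and> \<alpha>) \<^bold>\<or> (\<beta> \<^bold>\<and> \<alpha>)))"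
proof -
  have "insert \<alpha> \<Gamma> \<turnstile> (\<beta> \<^bold>\<or> \<gamma>) \<^bold>\<rightarrow>\<^sub>N (\<alpha> \<^bold>\<and> ((\<gamma> \<^bold>\<and> \<alpha>) \<^bold>\<or> (\<beta> \<^bold>\<and> \<alpha>)))"
    by (simp add: left_rules, intro conjI deduction)
      (simp_all add: decompose disjI1 disjI2)
  then show ?thesis
    unfolding conj_iff conj_impN_iff by (intro conjI deduction[of \<alpha>] ax[OF A22])
qed

lemma strong_kleene: "\<Gamma> \<turnstile> (\<alpha> \<^bold>\<and> \<^bold>\<sim> \<alpha>) \<^bold>\<Rightarrow> (\<beta> \<^bold>\<or> \<^bold>\<sim> \<beta>)"
  unfolding conj_iff left_rules
proof (intro conjI deduction)
  show "insert (\<^bold>\<sim> \<alpha>) (insert \<alpha> \<Gamma>) \<turnstile> \<beta> \<^bold>\<or> \<^bold>\<sim> \<beta>"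
    by (rule ex_falso_hyp[of \<alpha>]) simp_all
  show "insert (\<^bold>\<sim> \<^bold>\<sim> \<beta>) (insert (\<^bold>\<sim> \<beta>) \<Gamma>) \<turnstile> \<^bold>\<sim> (\<alpha> \<^bold>\<and> \<^bold>\<sim> \<alpha>)"
    by (rule ex_falso_hyp[of "\<^bold>\<sim> \<beta>"]) simp_all
qed

text \<open>
  Both halves exchange one argument at a time, passing through \<open>\<beta> \<^bold>\<rightarrow> \<gamma>\<close>. The negated half
  replaces \<open>\<gamma>\<close> by \<open>\<delta>\<close> below a negation, where the weak equivalence of \<open>\<gamma>\<close> and \<open>\<delta>\<close> does not
  suffice: \<open>\<^bold>\<sim> (\<beta> \<^bold>\<rightarrow> \<gamma>)\<close> means \<open>\<beta> \<^bold>\<and> \<^bold>\<sim> \<gamma>\<close>, so that \<open>\<^bold>\<sim> \<gamma>\<close> and \<open>\<^bold>\<sim> \<delta>\<close> have to be equivalent.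
\<close>
lemma strong_imp_cong:
  assumes "\<Gamma> \<turnstile> \<alpha> \<^bold>\<Rightarrow> \<beta>" "\<Gamma> \<turnstile> \<beta> \<^bold>\<Rightarrow> \<alpha>" "\<Gamma> \<turnstile> \<gamma> \<^bold>\<Rightarrow> \<delta>" "\<Gamma> \<turnstile> \<delta> \<^bold>\<Rightarrow> \<gamma>"
  shows "\<Gamma> \<turnstile> (\<alpha> \<^bold>\<rightarrow> \<gamma>) \<^bold>\<Rightarrow> (\<beta> \<^bold>\<rightarrow> \<delta>)"
proof -
  note weak = assms[unfolded conj_iff]
  have "\<Gamma> \<turnstile> (\<alpha> \<^bold>\<rightarrow> \<gamma>) \<^bold>\<rightarrow>\<^sub>N (\<beta> \<^bold>\<rightarrow> \<gamma>)"
    using weak ax[OF A13, of \<Gamma> \<alpha> \<beta> \<gamma>] N_MP by blast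
  moreover have "\<Gamma> \<turnstile> (\<beta> \<^bold>\<rightarrow> \<gamma>) \<^bold>\<rightarrow>\<^sub>N (\<beta> \<^bold>\<rightarrow> \<delta>)"
    using weak ax[OF A14, of \<Gamma> \<gamma> \<delta> \<beta>] N_MP by blast
  moreover have "\<Gamma> \<turnstile> \<^bold>\<sim> (\<beta> \<^bold>\<rightarrow> \<delta>) \<^bold>\<rightarrow>\<^sub>N \<^bold>\<sim> (\<beta> \<^bold>\<rightarrow> \<gamma>)"
    using weak neg_imp_consequent[of \<Gamma> \<delta> \<gamma> \<beta>] N_MP by blast
  moreover have "\<Gamma> \<turnstile> \<^bold>\<sim> (\<beta> \<^bold>\<rightarrow> \<gamma>) \<^bold>\<rightarrow>\<^sub>N \<^bold>\<sim> (\<alpha> \<^bold>\<rightarrow> \<gamma>)"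
    using weak neg_imp_antecedent[of \<Gamma> \<alpha> \<beta> \<gamma>] N_MP by blast
  ultimately show ?thesis unfolding conj_iff using impN_trans by blast
qed

lemma strong_const:
  assumes "\<Gamma> \<turnstile> \<alpha>"
  shows "\<Gamma> \<turnstile> \<beta> \<^bold>\<Rightarrow> \<alpha>"
  unfolding conj_iff
proof
  show "\<Gamma> \<turnstile> \<beta> \<^bold>\<rightarrow>\<^sub>N \<alpha>" using assms by (rule impN_const)
  have "insert (\<^bold>\<sim> \<alpha>) \<Gamma> \<turnstile> \<alpha>" using assms by (rule derives_mono) blast
  then show "\<Gamma> \<turnstile> \<^bold>\<sim> \<alpha> \<^bold>\<rightarrow>\<^sub>N \<^bold>\<sim> \<beta>"
    by (intro deduction) (erule ex_falso, simp add: hyp)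
qed

section \<open>The list of derived properties\<close>

theorem lemma2p3:
  fixes \<Gamma> :: "fm set" and \<alpha> \<beta> \<gamma> t :: fm
  shows
    "(\<Gamma> \<turnstile> (\<^bold>\<sim> \<alpha> \<^bold>\<and> \<^bold>\<sim> \<beta>) \<^bold>\<leftrightarrow>\<^sub>N \<^bold>\<sim> (\<alpha> \<^bold>\<or> \<beta>)) \<and>
     (\<Gamma> \<turnstile> (\<alpha> \<^bold>\<and> (\<alpha> \<^bold>\<rightarrow>\<^sub>N \<beta>)) \<^bold>\<Rightarrow> (\<alpha> \<^bold>\<and> (\<^bold>\<sim> \<alpha> \<^bold>\<or> \<beta>))) \<and>
     (\<Gamma> \<turnstile> \<alpha> \<^bold>\<leftrightarrow>\<^sub>N \<beta> \<longrightarrow> \<Gamma> \<turnstile> \<beta> \<^bold>\<leftrightarrow>\<^sub>N \<alpha>) \<and>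
     (\<Gamma> \<turnstile> \<alpha> \<^bold>\<Rightarrow> (\<alpha> \<^bold>\<and> (\<alpha> \<^bold>\<or> \<beta>))) \<and>
     (\<Gamma> \<turnstile> (\<alpha> \<^bold>\<and> ((\<gamma> \<^bold>\<and> \<alpha>) \<^bold>\<or> (\<beta> \<^bold>\<and> \<alpha>))) \<^bold>\<Rightarrow> (\<alpha> \<^bold>\<and> (\<beta> \<^bold>\<or> \<gamma>))) \<and>
     (\<Gamma> \<turnstile> (\<alpha> \<^bold>\<and> (\<beta> \<^bold>\<or> \<gamma>)) \<^bold>\<Rightarrow> (\<alpha> \<^bold>\<and> ((\<gamma> \<^bold>\<and> \<alpha>) \<^bold>\<or> (\<beta> \<^bold>\<and> \<alpha>)))) \<and>
     (\<Gamma> \<turnstile> (\<^bold>\<sim> \<beta> \<^bold>\<rightarrow>\<^sub>N \<^bold>\<sim> \<alpha>) \<^bold>\<rightarrow>\<^sub>N ((\<^bold>\<sim> \<gamma> \<^bold>\<rightarrow>\<^sub>N \<^bold>\<sim> \<alpha>) \<^bold>\<rightarrow>\<^sub>N (\<^bold>\<sim> (\<beta> \<^bold>\<and> \<gamma>) \<^bold>\<rightarrow>\<^sub>N \<^bold>\<sim> \<alpha>))) \<and>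
     (\<Gamma> \<turnstile> \<alpha> \<^bold>\<Rightarrow> \<beta> \<and> \<Gamma> \<turnstile> \<alpha> \<^bold>\<Rightarrow> \<gamma> \<longrightarrow>
        \<Gamma> \<turnstile> \<alpha> \<^bold>\<Rightarrow> (\<beta> \<^bold>\<and> \<gamma>) \<and> \<Gamma> \<turnstile> \<alpha> \<^bold>\<Rightarrow> (\<gamma> \<^bold>\<and> \<beta>)) \<and>
     (\<Gamma> \<turnstile> \<alpha> \<^bold>\<Rightarrow> \<beta> \<longrightarrow> \<Gamma> \<turnstile> \<alpha> \<^bold>\<Rightarrow> (\<beta> \<^bold>\<or> \<gamma>) \<and> \<Gamma> \<turnstile> \<alpha> \<^bold>\<Rightarrow> (\<gamma> \<^bold>\<or> \<beta>)) \<and>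
     (\<Gamma> \<turnstile> \<alpha> \<^bold>\<Rightarrow> \<beta> \<longrightarrow> \<Gamma> \<turnstile> (\<alpha> \<^bold>\<and> \<gamma>) \<^bold>\<Rightarrow> \<beta> \<and> \<Gamma> \<turnstile> (\<gamma> \<^bold>\<and> \<alpha>) \<^bold>\<Rightarrow> \<beta>) \<and>
     (\<Gamma> \<union> {\<alpha> \<^bold>\<Rightarrow> \<beta>} \<turnstile> (\<alpha> \<^bold>\<and> \<gamma>) \<^bold>\<Rightarrow> (\<beta> \<^bold>\<and> \<gamma>)) \<and>
     (\<Gamma> \<union> {\<alpha> \<^bold>\<Rightarrow> \<beta>} \<turnstile> (\<gamma> \<^bold>\<and> \<alpha>) \<^bold>\<Rightarrow> (\<gamma> \<^bold>\<and> \<beta>)) \<and>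
     (\<Gamma> \<union> {\<alpha> \<^bold>\<Rightarrow> \<beta>, \<gamma> \<^bold>\<Rightarrow> t} \<turnstile> (\<alpha> \<^bold>\<and> \<gamma>) \<^bold>\<Rightarrow> (\<beta> \<^bold>\<and> t)) \<and>
     (\<Gamma> \<turnstile> (\<^bold>\<sim> (\<alpha> \<^bold>\<rightarrow>\<^sub>N \<beta>)) \<^bold>\<rightarrow>\<^sub>N (\<alpha> \<^bold>\<and> \<^bold>\<sim> \<beta>)) \<and>
     (\<Gamma> \<turnstile> (\<alpha> \<^bold>\<and> \<^bold>\<sim> \<alpha>) \<^bold>\<rightarrow>\<^sub>N \<beta>) \<and>
     (\<Gamma> \<turnstile> (\<alpha> \<^bold>\<and> \<^bold>\<sim> \<alpha>) \<^bold>\<Rightarrow> (\<beta> \<^bold>\<or> \<^bold>\<sim> \<beta>)) \<and>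
     (\<Gamma> \<turnstile> (\<alpha> \<^bold>\<rightarrow>\<^sub>N \<beta>) \<^bold>\<rightarrow>\<^sub>N ((\<beta> \<^bold>\<rightarrow>\<^sub>N \<alpha>) \<^bold>\<rightarrow>\<^sub>N ((\<^bold>\<sim> (\<beta> \<^bold>\<rightarrow> \<gamma>)) \<^bold>\<rightarrow>\<^sub>N (\<^bold>\<sim> (\<alpha> \<^bold>\<rightarrow> \<gamma>))))) \<and>
     (\<Gamma> \<turnstile> (\<^bold>\<sim> \<alpha> \<^bold>\<rightarrow>\<^sub>N \<^bold>\<sim> \<beta>) \<^bold>\<rightarrow>\<^sub>N ((\<^bold>\<sim> \<beta> \<^bold>\<rightarrow>\<^sub>N \<^bold>\<sim> \<alpha>) \<^bold>\<rightarrow>\<^sub>N ((\<^bold>\<sim> (\<gamma> \<^bold>\<rightarrow> \<alpha>)) \<^bold>\<rightarrow>\<^sub>N (\<^bold>\<sim> (\<gamma> \<^bold>\<rightarrow> \<beta>))))) \<and>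
     (\<Gamma> \<union> {\<alpha> \<^bold>\<Rightarrow> \<beta>, \<beta> \<^bold>\<Rightarrow> \<alpha>, \<gamma> \<^bold>\<Rightarrow> t, t \<^bold>\<Rightarrow> \<gamma>} \<turnstile> (\<alpha> \<^bold>\<rightarrow> \<gamma>) \<^bold>\<Rightarrow> (\<beta> \<^bold>\<rightarrow> t)) \<and>
     (\<Gamma> \<union> {\<alpha>} \<turnstile> \<beta> \<^bold>\<Rightarrow> \<alpha>) \<and>
     (\<Gamma> \<turnstile> (\<alpha> \<^bold>\<rightarrow> \<beta>) \<^bold>\<rightarrow>\<^sub>N (\<alpha> \<^bold>\<rightarrow>\<^sub>N \<beta>))"
proof (intro conjI impI; (elim conjE)?)
  show "\<Gamma> \<turnstile> (\<^bold>\<sim> \<alpha> \<^bold>\<and> \<^bold>\<sim> \<beta>) \<^bold>\<leftrightarrow>\<^sub>N \<^bold>\<sim> (\<alpha> \<^bold>\<or> \<beta>)"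
    using neg_disj_iffN[of \<Gamma> \<alpha> \<beta>] by (simp add: conj_iff)
  show "\<Gamma> \<turnstile> \<beta> \<^bold>\<leftrightarrow>\<^sub>N \<alpha>" if "\<Gamma> \<turnstile> \<alpha> \<^bold>\<leftrightarrow>\<^sub>N \<beta>"
    using that by (simp add: conj_iff)
  show "\<Gamma> \<turnstile> (\<alpha> \<^bold>\<and> \<^bold>\<sim> \<alpha>) \<^bold>\<rightarrow>\<^sub>N \<beta>"
    unfolding conj_impN_iff by (intro deduction ex_falso_hyp[of \<alpha>]) simp_all
  (* In the claims with an extended set of hypotheses, "hyp" supplies the premises. *)
qed (rule strong_detachment strong_absorption strong_distrib_collect strong_distrib
    neg_conj_impN strong_conj_intro strong_trans[OF _ strong_disj_intro1]
    strong_trans[OF _ strong_disj_intro2] strong_trans[OF strong_conj_elim1]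
    strong_trans[OF strong_conj_elim2] strong_conj_mono[OF hyp strong_refl]
    strong_conj_mono[OF strong_refl hyp] strong_conj_mono[OF hyp hyp] neg_impN
    strong_kleene neg_imp_antecedent neg_imp_consequent
    strong_imp_cong[OF hyp hyp hyp hyp] strong_const[OF hyp] imp_impN;
    (assumption | blast))+

end
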